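(* Let $n\ge 1$ and consider the $n$-vertex Fibonacci graph $FG$ (vertices $1,\dots,n$; edges $(v,v+1)$ labelled $a_v$ for $1\le v\le n-1$ and $(v,v+2)$ labelled $b_v$ for $1\le v\le n-2$). Let $T(n)$ and $P(n)$ be the total number of terms and the number of plus operators in the expression of $FG$ produced by the optimal reduction method. Then: 1. $T(1)=0$, $T(2)=1$, $T(3)=3$, $T(4)=6$, $T(5)=9$, and $T(n)=T(n-2)+T(n-4)+7$ for $n>5$. 2. $P(1)=0$, $P(2)=0$, $P(3)=1$, $P(4)=2$, $P(5)=3$, and $P(n)=P(n-2)+P(n-4)+3$ for $n>5$.
   Context: Reduction processes (for $n\ge 3$). Edges carry labels; initially edge $(v,v+1)$ has label $a_v$ and $(v,v+2)$ has label $b_v$. At every stage the current labelled graph has vertices $u_1<\dots<u_k$ (with $u_1=1$, $u_k=n$) and edges $(u_r,u_{r+1})$, $(u_r,u_{r+2})$. While $k>3$, one step is performed: (Fork step) with labels $A,B,C,D$ on $(u_1,u_2),(u_2,u_3),(u_2,u_4),(u_1,u_3)$: delete $u_2$ and its incident edges, add $(u_1,u_4)$ labelled $AC$, and replace $(u_1,u_3)$ by an edge labelled $D+AB$. (Joint step) with labels $A,B,C,D$ on $(u_{k-1},u_k),(u_{k-2},u_{k-1}),(u_{k-3},u_{k-1}),(u_{k-2},u_k)$: delete $u_{k-1}$ and its incident edges, add $(u_{k-3},u_k)$ labelled $CA$, and replace $(u_{k-2},u_k)$ by an edge labelled $D+BA$. When $k=3$, with labels $A,B,D$ on $(u_1,u_2),(u_2,u_3),(u_1,u_3)$,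 the final expression is $D+AB$. For $n\le 2$ the graph is a single vertex (expression $1$, containing no terms) or a single edge (expression $a_1$). The optimal reduction method uses any process whose number $f$ of fork steps and number $j$ of joint steps satisfy $f=j$ for odd $n$ and $|f-j|=1$ for even $n$ (the term and plus counts of the result depend only on $n$). Sums are parenthesized when multiplied. The total number of terms of an expression is the number of occurrences of the labels $a_v,b_v$ in it, counted with multiplicity; the number of plus operators is the number of occurrences of $+$. *)

theory Defs
  imports Main
begin

datatype label = EdgeA nat | EdgeB nat

datatype expr = One | Lab label | Plus expr expr | Times expr expr

text \<open>
  Every occurrence of a label counts as one term; the constant \<open>One\<close> is not a term.
  Parentheses are represented by the tree structure.
\<close>

fun term_count :: "expr \<Rightarrow> nat" where
  "term_count One = 0"
| "term_count (Lab l) = 1"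
| "term_count (Plus x y) = term_count x + term_count y"
| "term_count (Times x y) = term_count x + term_count y"

fun plus_count :: "expr \<Rightarrow> nat" where
  "plus_count One = 0"
| "plus_count (Lab l) = 0"
| "plus_count (Plus x y) = plus_count x + plus_count y + 1"
| "plus_count (Times x y) = plus_count x + plus_count y"

text \<open>
  The vertices are listed in increasing order; the edges are the pairs in the domain of the
  labelling.
\<close>

type_synonym lgraph = "nat list \<times> (nat \<times> nat \<rightharpoonup> expr)"

definition fib_graph :: "nat \<Rightarrow> lgraph" where
  "fib_graph n =
     ([1..<Suc n],
      \<lambda>(u, v). if 1 \<le> u \<and> v \<le> n \<and> v = u + 1 then Some (Lab (EdgeA u))
               else if 1 \<le> u \<and> v \<le> n \<and> v = u + 2 then Some (Lab (EdgeB u))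
               else None)"

definition delete_incident :: "nat \<Rightarrow> (nat \<times> nat \<rightharpoonup> expr) \<Rightarrow> (nat \<times> nat \<rightharpoonup> expr)" where
  "delete_incident w L = L |` {(u, v). u \<noteq> w \<and> v \<noteq> w}"

text \<open>
  The list patterns force at least four vertices. In both steps the last map update
  overwrites the label of an edge already present.
\<close>

inductive fork_step :: "lgraph \<Rightarrow> lgraph \<Rightarrow> bool" where
  "\<lbrakk>L (u1, u2) = Some A; L (u2, u3) = Some B; L (u2, u4) = Some C; L (u1, u3) = Some D\<rbrakk>
   \<Longrightarrow> fork_step (u1 # u2 # u3 # u4 # us, L)
         (u1 # u3 # u4 # us,
          (delete_incident u2 L)((u1, u4) \<mapsto> Times A C, (u1, u3) \<mapsto> Plus D (Times A B)))"

inductive joint_step :: "lgraph \<Rightarrow> lgraph \<Rightarrow> bool" where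
  "\<lbrakk>L (w3, w4) = Some A; L (w2, w3) = Some B; L (w1, w3) = Some C; L (w2, w4) = Some D\<rbrakk>
   \<Longrightarrow> joint_step (us @ [w1, w2, w3, w4], L)
         (us @ [w1, w2, w4],
          (delete_incident w3 L)((w1, w4) \<mapsto> Times C A, (w2, w4) \<mapsto> Plus D (Times B A)))"

text \<open>
  \<open>reduction G f j e\<close>: some complete process with \<open>f\<close> fork steps and \<open>j\<close> joint steps, in any
  order, takes \<open>G\<close> to the final expression \<open>e\<close>.
\<close>

inductive reduction :: "lgraph \<Rightarrow> nat \<Rightarrow> nat \<Rightarrow> expr \<Rightarrow> bool" where
  final: "\<lbrakk>L (u1, u2) = Some A; L (u2, u3) = Some B; L (u1, u3) = Some D\<rbrakk>
          \<Longrightarrow> reduction ([u1, u2, u3], L) 0 0 (Plus D (Times A B))"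
| fork: "\<lbrakk>fork_step G G'; reduction G' f j e\<rbrakk> \<Longrightarrow> reduction G (Suc f) j e"
| joint: "\<lbrakk>joint_step G G'; reduction G' f j e\<rbrakk> \<Longrightarrow> reduction G f (Suc j) e"

text \<open>
  No process is run on the graphs with one or two vertices, so the parity condition on
  \<open>f\<close> and \<open>j\<close> applies from three vertices on.
\<close>

definition optimal_expr :: "nat \<Rightarrow> expr \<Rightarrow> bool" where
  "optimal_expr n e \<longleftrightarrow>
     (n = 1 \<and> e = One) \<or>
     (n = 2 \<and> e = Lab (EdgeA 1)) \<or>
     (n \<ge> 3 \<and> (\<exists>f j. reduction (fib_graph n) f j e \<and>
                       (if odd n then f = j else \<bar>int f - int j\<bar> = 1)))"

text \<open>
  An optimal process is in general not unique, and neither is its expression; the definite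
  descriptions are meaningful because the counts do not depend on the choice.
\<close>

definition T :: "nat \<Rightarrow> nat" where
  "T n = (THE t. \<exists>e. optimal_expr n e \<and> term_count e = t)"

definition P :: "nat \<Rightarrow> nat" where
  "P n = (THE p. \<exists>e. optimal_expr n e \<and> plus_count e = p)"

end

theory Submission
  imports Defs
begin

text \<open>
  A fork step only changes the labels of the two edges leaving the first vertex, and a joint step
  those of the two edges entering the last vertex. If the former have sizes \<open>p\<close> and \<open>q\<close>, a fork step
  turns them into \<open>p + q + t + w\<close> and \<open>p + t\<close>, where \<open>t\<close> is the size of a label and \<open>w\<close> that of a plus
  sign; joint steps act in the same way at the other end. The two ends do not interact until only
  three vertices are left, so that the size of the result is, up to a constant, the sum of a
  function of the number of fork steps and the same function of the number of joint steps. This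
  function satisfies a Fibonacci-like recurrence.
\<close>

fun end_size :: "nat \<Rightarrow> nat \<Rightarrow> nat \<Rightarrow> nat \<Rightarrow> nat \<Rightarrow> nat" where
  "end_size t w p q 0 = p + q"
| "end_size t w p q (Suc k) = end_size t w (p + q + t + w) (p + t) k"

text \<open>Unfolding one step in each of the three terms only changes the start values, all in the
  same way. With \<open>p\<close> and \<open>q\<close> arbitrary, the induction step is therefore
  the induction hypothesis at the new values.\<close>

lemma end_size_rec:
  "end_size t w p q (Suc (Suc k)) = end_size t w p q (Suc k) + end_size t w p q k + 3 * t + 2 * w"
proof (induction k arbitrary: p q)
  case (Suc k)
  show ?case
    by (subst (1 2 3) end_size.simps(2)) (rule Suc.IH)
qed simp

lemma end_size_two: "end_size t w p q 2 = 3 * p + 2 * q + 5 * t + 3 * w"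
  unfolding numeral_2_eq_2 by simp

section \<open>Label sizes under fork and joint steps\<close>

text \<open>Both counts are additive and differ only in the weight \<open>t\<close> of a label and
  \<open>w\<close> of a plus sign: terms have weights (1, 0), plus operators (0, 1). One argument
  thus serves both halves of the theorem.\<close>

locale expr_size =
  fixes m :: "expr \<Rightarrow> nat" and t w :: nat
  assumes m_Lab [simp]: "m (Lab l) = t"
    and m_Plus [simp]: "m (Plus x y) = m x + m y + w"
    and m_Times [simp]: "m (Times x y) = m x + m y"
begin

text \<open>
  The two summands on the right-hand sides are the contributions of the two ends. For three
  vertices, the edge from the first to the last one receives both; this is why \<open>t\<close> is added on the
  left.
\<close>

definition ladder :: "lgraph \<Rightarrow> nat \<Rightarrow> nat \<Rightarrow> nat \<Rightarrow> nat \<Rightarrow> bool" where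
  "ladder G p q r s \<longleftrightarrow> (case G of (xs, L) \<Rightarrow>
     distinct xs \<and> 3 \<le> length xs \<and>
     (\<forall>i. i + 1 < length xs \<longrightarrow> (\<exists>A. L (xs ! i, xs ! (i + 1)) = Some A \<and>
        m A + t = (if i = 0 then p else t) + (if i + 2 = length xs then r else t))) \<and>
     (\<forall>i. i + 2 < length xs \<longrightarrow> (\<exists>A. L (xs ! i, xs ! (i + 2)) = Some A \<and>
        m A + t = (if i = 0 then q else t) + (if i + 3 = length xs then s else t))))"

lemma ladder_distinct: "ladder (xs, L) p q r s \<Longrightarrow> distinct xs"
  by (simp add: ladder_def)

lemma ladder_length: "ladder (xs, L) p q r s \<Longrightarrow> 3 \<le> length xs"
  by (simp add: ladder_def)

lemma ladder_short:
  assumes "ladder (xs, L) p q r s" "i + 1 < length xs"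
  shows "\<exists>A. L (xs ! i, xs ! (i + 1)) = Some A \<and>
    m A + t = (if i = 0 then p else t) + (if i + 2 = length xs then r else t)"
  using assms unfolding ladder_def by blast

lemma ladder_long:
  assumes "ladder (xs, L) p q r s" "i + 2 < length xs"
  shows "\<exists>A. L (xs ! i, xs ! (i + 2)) = Some A \<and>
    m A + t = (if i = 0 then q else t) + (if i + 3 = length xs then s else t)"
  using assms unfolding ladder_def by blast

lemma ladder_fib_graph:
  assumes "3 \<le> n"
  shows "ladder (fib_graph n) t t t t"
proof -
  have nth: "[1..<Suc n] ! i = i + 1" if "i < n" for i
    using that by (simp add: nth_upt del: upt_Suc)
  show ?thesis
    unfolding ladder_def fib_graph_def prod.case
    using assms by (simp add: nth del: upt_Suc)
qed

lemma ladder_fork_step: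
  assumes "fork_step G G'" "ladder G p q r s"
  shows "ladder G' (p + q + t + w) (p + t) r s"
  using assms
proof (cases rule: fork_step.cases)
  case (1 L u1 u2 A u3 B u4 C D us)
  let ?xs = "u1 # u2 # u3 # u4 # us" and ?ys = "u1 # u3 # u4 # us"
  let ?L = "(delete_incident u2 L)((u1, u4) \<mapsto> Times A C, (u1, u3) \<mapsto> Plus D (Times A B))"
  have lad: "ladder (?xs, L) p q r s" using assms 1 by simp
  note dist = ladder_distinct [OF lad]
  have mA: "m A = p" using ladder_short [OF lad, of 0] 1 by simp
  have mB: "m B = t" using ladder_short [OF lad, of 1] 1 by simp
  \<comment> \<open>If \<open>us\<close> is empty, \<open>u4\<close> is the last vertex, so this
    edge belongs to the other end and has size \<open>s\<close>.\<close>
  have mC: "m C = (if us = [] then s else t)" using ladder_long [OF lad, of 1] 1 by auto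
  have mD: "m D = q" using ladder_long [OF lad, of 0] 1 by simp
  \<comment> \<open>Both updated edges leave \<open>u1\<close>, so edges leaving later vertices keep
    their labels; their positions drop by one because \<open>u2\<close> is gone.\<close>
  have L_eq: "?L (?ys ! Suc i, v) = L (?xs ! Suc (Suc i), v)"
    if "i + 2 < length ?ys" "v \<noteq> u2" for i v
  proof -
    have "?ys ! Suc i \<in> set (u3 # u4 # us)" using that by (auto simp: nth_Cons')
    then have "?ys ! Suc i \<noteq> u1" "?ys ! Suc i \<noteq> u2" using dist by auto
    then show ?thesis using that by (simp add: delete_incident_def restrict_map_def)
  qed
  have nth_neq: "(u3 # u4 # us) ! i \<noteq> u2" if "i < length us + 2" for i
  proof -
    have "(u3 # u4 # us) ! i \<in> set (u3 # u4 # us)" using that by (intro nth_mem) simp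
    then show ?thesis using dist by auto
  qed
  have "ladder (?ys, ?L) (p + q + t + w) (p + t) r s"
    unfolding ladder_def prod.case
  proof (intro conjI allI impI)
    show "distinct ?ys" using dist by auto
  next
    fix i assume i: "i + 1 < length ?ys"
    show "\<exists>X. ?L (?ys ! i, ?ys ! (i + 1)) = Some X \<and>
        m X + t = (if i = 0 then p + q + t + w else t) + (if i + 2 = length ?ys then r else t)"
    proof (cases i)
      case 0
      then show ?thesis using mA mB mD by simp
    next
      case (Suc i')
      then show ?thesis
        using L_eq [of i' "?ys ! (i + 1)"] nth_neq [of i] i ladder_short [OF lad, of "i + 1"]
        by auto
    qed
  next
    fix i assume i: "i + 2 < length ?ys"
    show "\<exists>X. ?L (?ys ! i, ?ys ! (i + 2)) = Some X \<and>
        m X + t = (if i = 0 then p + t else t) + (if i + 3 = length ?ys then s else t)"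
    proof (cases i)
      case 0
      then show ?thesis using mA mC dist by auto
    next
      case (Suc i')
      then show ?thesis
        using L_eq [of i' "?ys ! (i + 2)"] nth_neq [of "i + 1"] i ladder_long [OF lad, of "i + 1"]
        by auto
    qed
  qed simp
  then show ?thesis using 1 by simp
qed

lemma ladder_joint_step:
  assumes "joint_step G G'" "ladder G p q r s"
  shows "ladder G' p q (r + s + t + w) (r + t)"
  using assms
proof (cases rule: joint_step.cases)
  case (1 L w3 w4 A w2 B w1 C D us)
  let ?xs = "us @ [w1, w2, w3, w4]" and ?ys = "us @ [w1, w2, w4]" and ?k = "length us"
  let ?L = "(delete_incident w3 L)((w1, w4) \<mapsto> Times C A, (w2, w4) \<mapsto> Plus D (Times B A))"
  have lad: "ladder (?xs, L) p q r s" using assms 1 by simp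
  note dist = ladder_distinct [OF lad]
  have mA: "m A = r" using ladder_short [OF lad, of "?k + 2"] 1 by (simp add: nth_append)
  have mB: "m B = t" using ladder_short [OF lad, of "?k + 1"] 1 by (simp add: nth_append)
  have mC: "m C = (if us = [] then q else t)"
    using ladder_long [OF lad, of ?k] 1 by (auto simp: nth_append)
  have mD: "m D = s" using ladder_long [OF lad, of "?k + 1"] 1 by (simp add: nth_append)
  have nth_eq: "?ys ! i = ?xs ! i" if "i < ?k + 2" for i
    using that by (auto simp: nth_append nth_Cons')
  have nth_neq: "?xs ! i \<noteq> w3 \<and> ?xs ! i \<noteq> w4" if "i < ?k + 2" for i
  proof -
    have "?xs ! i \<in> set (us @ [w1, w2])" using that by (auto simp: nth_append nth_Cons')
    then show ?thesis using dist by auto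
  qed
  \<comment> \<open>Both updated edges enter \<open>w4\<close>, so edges among the first
    \<open>?k + 2\<close> vertices keep their labels, here without an index shift.\<close>
  have L_eq: "?L (?ys ! i, ?ys ! i') = L (?xs ! i, ?xs ! i')"
    if "i < ?k + 2" "i' < ?k + 2" for i i'
    using that nth_neq [of i] nth_neq [of i'] nth_eq
    by (simp add: delete_incident_def restrict_map_def)
  have "ladder (?ys, ?L) p q (r + s + t + w) (r + t)"
    unfolding ladder_def prod.case
  proof (intro conjI allI impI)
    show "distinct ?ys" using dist by auto
  next
    fix i assume i: "i + 1 < length ?ys"
    show "\<exists>X. ?L (?ys ! i, ?ys ! (i + 1)) = Some X \<and>
        m X + t = (if i = 0 then p else t) + (if i + 2 = length ?ys then r + s + t + w else t)"
    proof (cases "i = ?k + 1")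
      case True
      then show ?thesis using mA mB mD by (simp add: nth_append)
    next
      case False
      then show ?thesis
        using L_eq [of i "i + 1"] i ladder_short [OF lad, of i] by simp
    qed
  next
    fix i assume i: "i + 2 < length ?ys"
    show "\<exists>X. ?L (?ys ! i, ?ys ! (i + 2)) = Some X \<and>
        m X + t = (if i = 0 then q else t) + (if i + 3 = length ?ys then r + t else t)"
    proof (cases "i = ?k")
      case True
      then show ?thesis using mA mC dist by (auto simp: nth_append)
    next
      case False
      then show ?thesis
        using L_eq [of i "i + 2"] i ladder_long [OF lad, of i] by simp
    qed
  qed simp
  then show ?thesis using 1 by simp
qed

text \<open>A fork step changes \<open>(p, q)\<close> and a joint step \<open>(r, s)\<close>, each
  exactly as one unfolding of \<open>end_size\<close> does. Hence the order of the steps does not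
  matter.\<close>

lemma reduction_size:
  assumes "reduction G f j e" "ladder G p q r s"
  shows "m e + t = end_size t w p q f + end_size t w r s j + w"
  using assms
proof (induction arbitrary: p q r s rule: reduction.induct)
  case (final L u1 u2 A u3 B D)
  have "m A = p" using ladder_short [OF final.prems, of 0] final.hyps by simp
  moreover have "m B = r" using ladder_short [OF final.prems, of 1] final.hyps by simp
  \<comment> \<open>The outer edge belongs to both ends, so \<open>q + s\<close> exceeds its size by
    \<open>t\<close>; this is the \<open>t\<close> on the left of the claim.\<close>
  moreover have "m D + t = q + s" using ladder_long [OF final.prems, of 0] final.hyps by simp
  ultimately show ?case by simp
next
  case (fork G G' f j e)
  then show ?case using ladder_fork_step by fastforce
next
  case (joint G G' f j e)
  then show ?case using ladder_joint_step by fastforce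
qed

section \<open>Existence of complete reductions\<close>

lemma ladder_fork_stepE:
  assumes "ladder (xs, L) p q r s" "4 \<le> length xs"
  obtains ys L' where "fork_step (xs, L) (ys, L')" "length xs = Suc (length ys)"
proof -
  obtain u1 u2 u3 u4 us where xs: "xs = u1 # u2 # u3 # u4 # us"
    using assms(2) by (auto simp: numeral_eq_Suc Suc_le_length_iff)
  obtain A where A: "L (u1, u2) = Some A"
    using ladder_short [OF assms(1), of 0] xs by auto
  obtain B where B: "L (u2, u3) = Some B"
    using ladder_short [OF assms(1), of 1] xs by auto
  obtain C where C: "L (u2, u4) = Some C"
    using ladder_long [OF assms(1), of 1] xs by auto
  obtain D where D: "L (u1, u3) = Some D"
    using ladder_long [OF assms(1), of 0] xs by auto
  show ?thesis
    using that [OF fork_step.intros [where us = us, OF A B C D, folded xs]] by (simp add: xs)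
qed

lemma ladder_joint_stepE:
  assumes "ladder (xs, L) p q r s" "4 \<le> length xs"
  obtains ys L' where "joint_step (xs, L) (ys, L')" "length xs = Suc (length ys)"
proof -
  \<comment> \<open>Reversal lets the last four vertices be split off as a prefix.\<close>
  obtain ys where ys: "rev xs = ys" "4 \<le> length ys" using assms(2) by simp
  obtain w4 w3 w2 w1 vs where "ys = w4 # w3 # w2 # w1 # vs"
    using ys(2) by (auto simp: numeral_eq_Suc Suc_le_length_iff)
  with ys(1) have "xs = rev vs @ [w1, w2, w3, w4]"
    by (simp add: rev_swap)
  then obtain us where xs: "xs = us @ [w1, w2, w3, w4]" ..
  let ?k = "length us"
  obtain A where A: "L (w3, w4) = Some A"
    using ladder_short [OF assms(1), of "?k + 2"] xs by (auto simp: nth_append)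
  obtain B where B: "L (w2, w3) = Some B"
    using ladder_short [OF assms(1), of "?k + 1"] xs by (auto simp: nth_append)
  obtain C where C: "L (w1, w3) = Some C"
    using ladder_long [OF assms(1), of ?k] xs by (auto simp: nth_append)
  obtain D where D: "L (w2, w4) = Some D"
    using ladder_long [OF assms(1), of "?k + 1"] xs by (auto simp: nth_append)
  show ?thesis
    using that [OF joint_step.intros [where us = us, OF A B C D, folded xs]] by (simp add: xs)
qed

text \<open>The ladder property supplies the labels required by either step and survives it, so no
  process gets stuck. The one built here performs all fork steps first.\<close>

lemma reduction_exists:
  assumes "ladder (xs, L) p q r s" "length xs = f + j + 3"
  shows "\<exists>e. reduction (xs, L) f j e"
  using assms
proof (induction "f + j" arbitrary: xs L f j p q r s)
  case 0
  then obtain u1 u2 u3 where xs: "xs = [u1, u2, u3]"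
    by (auto simp: numeral_eq_Suc length_Suc_conv)
  have "\<exists>A. L (u1, u2) = Some A" "\<exists>B. L (u2, u3) = Some B" "\<exists>D. L (u1, u3) = Some D"
    using ladder_short [OF 0(2), of 0] ladder_short [OF 0(2), of 1] ladder_long [OF 0(2), of 0] xs
    by auto
  then show ?case using reduction.final 0(1) xs by fastforce
next
  case (Suc k)
  have len: "4 \<le> length xs" using Suc by simp
  show ?case
  proof (cases f)
    case 0
    then obtain j' where j: "j = Suc j'" using Suc.hyps(2) by (cases j) auto
    obtain ys L' where st: "joint_step (xs, L) (ys, L')" "length xs = Suc (length ys)"
      using ladder_joint_stepE [OF Suc.prems(1) len] .
    have "\<exists>e. reduction (ys, L') f j' e"
      using Suc.hyps(1) [OF _ ladder_joint_step [OF st(1) Suc.prems(1)]] Suc.hyps(2) Suc.prems st(2) j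
      by simp
    then show ?thesis using reduction.joint [OF st(1)] j by blast
  next
    case f: (Suc f')
    obtain ys L' where st: "fork_step (xs, L) (ys, L')" "length xs = Suc (length ys)"
      using ladder_fork_stepE [OF Suc.prems(1) len] .
    have "\<exists>e. reduction (ys, L') f' j e"
      using Suc.hyps(1) [OF _ ladder_fork_step [OF st(1) Suc.prems(1)]] Suc.hyps(2) Suc.prems st(2) f
      by simp
    then show ?thesis using reduction.fork [OF st(1)] f by blast
  qed
qed

end

section \<open>Sizes of optimal expressions\<close>

lemma fork_step_length: "fork_step G G' \<Longrightarrow> length (fst G) = Suc (length (fst G'))"
  by (erule fork_step.cases) simp

lemma joint_step_length: "joint_step G G' \<Longrightarrow> length (fst G) = Suc (length (fst G'))"
  by (erule joint_step.cases) simp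

lemma reduction_length: "reduction G f j e \<Longrightarrow> length (fst G) = f + j + 3"
  by (induction rule: reduction.induct) (simp_all add: fork_step_length joint_step_length)

interpretation terms: expr_size term_count 1 0
  by unfold_locales simp_all

interpretation pluses: expr_size plus_count 0 1
  by unfold_locales simp_all

lemma optimal_expr_exists:
  assumes "1 \<le> n"
  shows "\<exists>e. optimal_expr n e"
proof (cases "3 \<le> n")
  case True
  \<comment> \<open>These numbers sum to \<open>n - 3\<close>, are equal for odd \<open>n\<close>
    and differ by one for even \<open>n\<close>.\<close>
  let ?f = "(n - 2) div 2" and ?j = "(n - 3) div 2"
  have "\<exists>e. reduction (fib_graph n) ?f ?j e"
    using terms.reduction_exists [of "fst (fib_graph n)" "snd (fib_graph n)" _ _ _ _ ?f ?j]
      terms.ladder_fib_graph [OF True] True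
    by (simp add: fib_graph_def)
  moreover have "if odd n then ?f = ?j else \<bar>int ?f - int ?j\<bar> = 1"
    using True by presburger
  ultimately show ?thesis using True unfolding optimal_expr_def by blast
next
  case False
  then have "n = 1 \<or> n = 2" using assms by auto
  then show ?thesis by (auto simp: optimal_expr_def)
qed

context expr_size
begin

lemma optimal_expr_size:
  assumes "3 \<le> n" "optimal_expr n e"
  shows "m e + t = end_size t w t t ((n - 2) div 2) + end_size t w t t ((n - 3) div 2) + w"
proof -
  obtain f j where red: "reduction (fib_graph n) f j e"
    and bal: "if odd n then f = j else \<bar>int f - int j\<bar> = 1"
    using assms by (auto simp: optimal_expr_def)
  have "n = f + j + 3" using reduction_length [OF red] assms(1) by (simp add: fib_graph_def)
  \<comment> \<open>Sum and parity condition determine \<open>f\<close> and \<open>j\<close> up to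
    exchange. The exchange is harmless, since both ends start with the values \<open>t\<close> and
    \<open>t\<close>.\<close>
  then have "f = (n - 2) div 2 \<and> j = (n - 3) div 2 \<or> j = (n - 2) div 2 \<and> f = (n - 3) div 2"
    using bal by (cases "odd n") (simp_all, presburger+)
  then show ?thesis
    using reduction_size [OF red ladder_fib_graph [OF assms(1)]] by auto
qed

text \<open>This makes the definite descriptions defining \<open>T\<close> and \<open>P\<close>
  meaningful.\<close>

lemma optimal_expr_size_unique:
  assumes "optimal_expr n e" "optimal_expr n e'"
  shows "m e = m e'"
proof (cases "3 \<le> n")
  case True
  then show ?thesis using optimal_expr_size [OF True] assms by (metis add_right_cancel)
next
  case False
  then show ?thesis using assms by (auto simp: optimal_expr_def)
qed

end

lemma T_eq: "optimal_expr n e \<Longrightarrow> T n = term_count e"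
  unfolding T_def by (rule the_equality) (use terms.optimal_expr_size_unique in metis)+

lemma P_eq: "optimal_expr n e \<Longrightarrow> P n = plus_count e"
  unfolding P_def by (rule the_equality) (use pluses.optimal_expr_size_unique in metis)+

section \<open>Closed forms and recurrences\<close>

lemma T_closed:
  assumes "3 \<le> n"
  shows "T n + 1 = end_size 1 0 1 1 ((n - 2) div 2) + end_size 1 0 1 1 ((n - 3) div 2)"
proof -
  obtain e where "optimal_expr n e" using optimal_expr_exists [of n] assms by auto
  then show ?thesis using terms.optimal_expr_size [OF assms] T_eq by simp
qed

lemma P_closed:
  assumes "3 \<le> n"
  shows "P n = end_size 0 1 0 0 ((n - 2) div 2) + end_size 0 1 0 0 ((n - 3) div 2) + 1"
proof -
  obtain e where "optimal_expr n e" using optimal_expr_exists [of n] assms by auto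
  then show ?thesis using pluses.optimal_expr_size [OF assms] P_eq by simp
qed

lemma T_P_small: "T 1 = 0" "T 2 = 1" "P 1 = 0" "P 2 = 0"
  using T_eq [of 1 One] T_eq [of 2 "Lab (EdgeA 1)"] P_eq [of 1 One] P_eq [of 2 "Lab (EdgeA 1)"]
  by (simp_all add: optimal_expr_def)

lemma T_P_base: "T 3 = 3" "T 4 = 6" "T 5 = 9" "P 3 = 1" "P 4 = 2" "P 5 = 3"
  using T_closed [of 3] T_closed [of 4] T_closed [of 5]
    P_closed [of 3] P_closed [of 4] P_closed [of 5]
  by simp_all

lemma T_P_rec:
  assumes "5 < n"
  shows "T n = T (n - 2) + T (n - 4) + 7" "P n = P (n - 2) + P (n - 4) + 3"
proof -
  have "T n = T (n - 2) + T (n - 4) + 7 \<and> P n = P (n - 2) + P (n - 4) + 3"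
  proof (cases "n = 6")
    \<comment> \<open>Here \<open>n - 4\<close> is 2, outside the range of the closed forms.\<close>
    case True
    then show ?thesis
      using T_closed [of 6] P_closed [of 6] T_P_small T_P_base by (simp add: end_size_two)
  next
    case False
    \<comment> \<open>Now \<open>n - 4\<close> is at least 3, and lowering \<open>n\<close> by two
      removes one step at each end.\<close>
    define k where "k = n - 7"
    have n: "n = k + 7" using False assms by (simp add: k_def)
    have "(n - 2) div 2 = Suc (Suc ((k + 1) div 2))" "(n - 3) div 2 = Suc (Suc (k div 2))"
      "(n - 2 - 2) div 2 = Suc ((k + 1) div 2)" "(n - 2 - 3) div 2 = Suc (k div 2)"
      "(n - 4 - 2) div 2 = (k + 1) div 2" "(n - 4 - 3) div 2 = k div 2"
      unfolding n by presburger+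
    \<comment> \<open>Each end contributes \<open>3 * t + 2 * w\<close>. With the offsets in the
      closed forms, the constants are 2 * 3 + 1 = 7 for \<open>T\<close> and 2 * 2 - 1 = 3 for
      \<open>P\<close>.\<close>
    then show ?thesis
      using T_closed [of n] T_closed [of "n - 2"] T_closed [of "n - 4"]
        P_closed [of n] P_closed [of "n - 2"] P_closed [of "n - 4"] n
      by (simp add: end_size_rec del: end_size.simps)
  qed
  then show "T n = T (n - 2) + T (n - 4) + 7" "P n = P (n - 2) + P (n - 4) + 3" by auto
qed

theorem theorem5:
  "(\<forall>n\<ge>1. (\<exists>e. optimal_expr n e) \<and>
           (\<forall>e. optimal_expr n e \<longrightarrow> term_count e = T n \<and> plus_count e = P n)) \<and>
   (T 1 = 0 \<and> T 2 = 1 \<and> T 3 = 3 \<and> T 4 = 6 \<and> T 5 = 9 \<and>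
     (\<forall>n>5. T n = T (n - 2) + T (n - 4) + 7)) \<and>
   (P 1 = 0 \<and> P 2 = 0 \<and> P 3 = 1 \<and> P 4 = 2 \<and> P 5 = 3 \<and>
     (\<forall>n>5. P n = P (n - 2) + P (n - 4) + 3))"
proof (intro conjI allI impI)
  fix n e
  assume "optimal_expr n e"
  then show "term_count e = T n" "plus_count e = P n" by (simp_all add: T_eq P_eq)
qed (fact optimal_expr_exists T_P_small T_P_base T_P_rec)+

end
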